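(* Let $d\in\mathbb{N}$, let $U\subset\mathbb{R}^d$, let $V\subset\mathbb{R}^d$ be a Delone set, let $a\in U$ and let $f:U\to V$ be a Lipschitz bijection. Then $f$ is co-Lipschitz at $f(a)$ if and only if $f$ is pointwise co-Lipschitz.
   Context: $\mathbb{N}=\{1,2,\dots\}$ and $\|\cdot\|$ is the Euclidean norm. A set $V\subset\mathbb{R}^d$ is a Delone set if there is $s>0$ such that every closed ball of radius $s$ in $\mathbb{R}^d$ contains at most one point of $V$, and there is $S>0$ such that every closed ball of radius $S$ in $\mathbb{R}^d$ contains at least one point of $V$. For a bijection $f:U\to V$ and $v\in V$: $f$ is co-Lipschitz at $v$ if there is $L=L(v)>0$ with $\|f^{-1}(w)-f^{-1}(v)\|\le L\|w-v\|$ for every $w\in V$; $f$ is pointwise co-Lipschitz if it is co-Lipschitz at every $v\in V$ (the constant may depend on $v$). *)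

theory Defs
  imports "HOL-Analysis.Analysis"
begin

definition delone :: "(real ^ 'n) set \<Rightarrow> bool" where
  "delone V \<longleftrightarrow>
     (\<exists>s>0. \<forall>x. \<exists>\<^sub>\<le>\<^sub>1p. p \<in> V \<inter> cball x s) \<and>
     (\<exists>S>0. \<forall>x. \<exists>p. p \<in> V \<inter> cball x S)"

text \<open>The next two notions are intended for \<open>bij_betw f U V\<close>; the inverse of
  \<open>f : U \<rightarrow> V\<close> is then \<open>inv_into U f\<close> on \<open>V\<close>.\<close>

definition co_lipschitz_at ::
    "(real ^ 'n) set \<Rightarrow> (real ^ 'n) set \<Rightarrow> (real ^ 'n \<Rightarrow> real ^ 'n) \<Rightarrow> real ^ 'n \<Rightarrow> bool" where
  "co_lipschitz_at U V f v \<longleftrightarrow>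
     (\<exists>L>0. \<forall>w\<in>V. norm (inv_into U f w - inv_into U f v) \<le> L * norm (w - v))"

definition pointwise_co_lipschitz ::
    "(real ^ 'n) set \<Rightarrow> (real ^ 'n) set \<Rightarrow> (real ^ 'n \<Rightarrow> real ^ 'n) \<Rightarrow> bool" where
  "pointwise_co_lipschitz U V f \<longleftrightarrow> (\<forall>v\<in>V. co_lipschitz_at U V f v)"

end

theory Submission
  imports Defs
begin

text \<open>If two distinct points of \<open>V\<close> were at distance at most \<open>s\<close>,
  the closed ball of radius \<open>s\<close> centred at one of them would contain both. Centring at
  a point of \<open>V\<close> rather than at a midpoint gives separation \<open>s\<close> instead of
  \<open>2 * s\<close>, which is enough here.\<close>

lemma delone_uniformly_discrete:
  assumes "delone V"
  obtains s where "s > 0" "\<And>v w. v \<in> V \<Longrightarrow> w \<in> V \<Longrightarrow> v \<noteq> w \<Longrightarrow> s < norm (w - v)"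
proof -
  obtain s where s: "s > 0" "\<And>x. \<exists>\<^sub>\<le>\<^sub>1p. p \<in> V \<inter> cball x s"
    using assms unfolding delone_def by blast
  have "s < norm (w - v)" if "v \<in> V" "w \<in> V" "v \<noteq> w" for v w
  proof (rule ccontr)
    assume "\<not> s < norm (w - v)"
    then have "w \<in> V \<inter> cball v s" and "v \<in> V \<inter> cball v s"
      using that s(1) by (auto simp: dist_norm norm_minus_commute)
    with s(2)[of v] have "v = w"
      by (blast dest: Uniq_D)
    with that show False
      by simp
  qed
  with s(1) that show ?thesis
    by blast
qed

text \<open>Moving the base point from \<open>b\<close> to \<open>v\<close> changes the co-Lipschitz estimate by an additive
  constant, which the separation of \<open>V\<close> absorbs into the multiplicative one.\<close>

lemma co_lipschitz_at_change_point:
  assumes V: "delone V" and b: "co_lipschitz_at U V f b" and v: "v \<in> V"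
  shows "co_lipschitz_at U V f v"
proof -
  let ?g = "inv_into U f"
  obtain s where s: "s > 0" "\<And>w. w \<in> V \<Longrightarrow> v \<noteq> w \<Longrightarrow> s < norm (w - v)"
    using delone_uniformly_discrete[OF V] v by metis
  obtain L where L: "L > 0" "\<And>w. w \<in> V \<Longrightarrow> norm (?g w - ?g b) \<le> L * norm (w - b)"
    using b unfolding co_lipschitz_at_def by blast
  \<comment> \<open>The detour through \<open>b\<close> costs \<open>L * norm (v - b)\<close> twice:
    once for \<open>norm (?g v - ?g b)\<close>, once for replacing \<open>w - b\<close> by
    \<open>w - v\<close>.\<close>
  define K where "K = 2 * L * norm (v - b)"
  have K: "K \<ge> 0"
    using L(1) by (simp add: K_def)
  have "norm (?g w - ?g v) \<le> (L + K / s) * norm (w - v)" if w: "w \<in> V" for w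
  \<comment> \<open>The separation bound requires \<open>w \<noteq> v\<close>; for
    \<open>w = v\<close> both sides vanish.\<close>
  proof (cases "w = v")
    case False
    have "norm (?g w - ?g v) \<le> norm (?g w - ?g b) + norm (?g v - ?g b)"
      by (metis norm_triangle_ineq4 diff_diff_eq2 diff_add_cancel)
    also have "\<dots> \<le> L * norm (w - b) + L * norm (v - b)"
      using L(2)[OF w] L(2)[OF v] by linarith
    also have "\<dots> \<le> L * (norm (w - v) + norm (v - b)) + L * norm (v - b)"
      using L(1) norm_triangle_ineq[of "w - v" "v - b"] by simp
    \<comment> \<open>Splitting off the factor \<open>s\<close> lets \<open>s < norm (w - v)\<close>
      turn the additive error \<open>K\<close> into a multiple of
      \<open>norm (w - v)\<close>.\<close>
    also have "\<dots> = L * norm (w - v) + K / s * s"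
      using s(1) by (simp add: K_def algebra_simps)
    also have "\<dots> \<le> L * norm (w - v) + K / s * norm (w - v)"
      using s(2)[OF w] False K s(1) by (intro add_left_mono mult_left_mono) auto
    finally show ?thesis
      by (simp add: algebra_simps)
  qed simp
  moreover have "L + K / s > 0"
    using L(1) K s(1) by (simp add: add_pos_nonneg)
  ultimately show ?thesis
    unfolding co_lipschitz_at_def by blast
qed

theorem proposition1p4:
  fixes U V :: "(real ^ 'n) set"
    and f :: "real ^ 'n \<Rightarrow> real ^ 'n"
    and a :: "real ^ 'n"
  assumes "delone V"
    and "a \<in> U"
    and "bij_betw f U V"
    and "\<exists>C. lipschitz_on C U f"
  shows "co_lipschitz_at U V f (f a) \<longleftrightarrow> pointwise_co_lipschitz U V f"
  \<comment> \<open>Forwards, the base point moves from \<open>f a\<close> to each \<open>v\<close>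
    in \<open>V\<close>; backwards, \<open>f a \<in> V\<close> is one of the points quantified
    over.\<close>
  using co_lipschitz_at_change_point[OF assms(1)] bij_betwE[OF assms(3)] assms(2)
  unfolding pointwise_co_lipschitz_def by blast

end
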